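(* Let $G$ be a connected graph on $n$ vertices whose block decomposition is nontrivial (i.e. $G$ has at least two blocks), and suppose that every block $B$ of $G$ has a spanning path (a path in $B$ containing all vertices of $B$) one of whose endpoints is a cut vertex of $G$. Then $G$ has a spanning tree $T$ in which the number of internal vertices is $n - |\mathrm{Bad}(G)|$.
   Context: All graphs are simple and undirected. A block of $G$ is a maximal connected subgraph of $G$ without cut vertices. A vertex of a tree is internal if its degree in the tree is at least $2$. For a block $B$ of $G$ and vertices $u,v\in V(B)$, a spanning path between $u$ and $v$ in $B$ is a path from $u$ to $v$ containing all vertices of $B$. A block $B$ is good if there exist distinct $u,v\in V(B)$, both cut vertices of $G$, such that $B$ has a spanning path between $u$ and $v$; otherwise $B$ is bad. $\mathrm{Bad}(G)$ denotes the set of bad blocks of $G$. *)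

theory Defs
  imports "Graph_Theory.Graph_Theory"
begin

text \<open>
  The locale predicate \<open>Digraph.graph\<close> models a finite simple undirected graph as a finite,
  symmetric digraph without loops and parallel arcs: an edge \<open>uv\<close> is the pair of arcs from
  \<open>u\<close> to \<open>v\<close> and from \<open>v\<close> to \<open>u\<close>. Note that \<open>subgraph H G\<close> does not force \<open>H\<close> to be
  symmetric, so every subgraph below that is meant as an undirected one is required
  explicitly to be a \<open>graph\<close>. \<open>Digraph_Component.connected\<close> includes non-emptiness.
\<close>

text \<open>
  A cut vertex separates two other vertices of its component, i.e. deleting it increases the
  number of components.
\<close>

definition cut_vertex :: "('a, 'b) pre_digraph \<Rightarrow> 'a \<Rightarrow> bool" where
  "cut_vertex G v \<longleftrightarrow> v \<in> verts G \<and>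
     (\<exists>u \<in> verts G - {v}. \<exists>w \<in> verts G - {v}.
        u \<rightarrow>\<^sup>*\<^bsub>G\<^esub> w \<and> \<not> u \<rightarrow>\<^sup>*\<^bsub>pre_digraph.del_vert G v\<^esub> w)"

definition blocks :: "('a, 'b) pre_digraph \<Rightarrow> ('a, 'b) pre_digraph set" where
  "blocks G = {B. pre_digraph.max_subgraph G
     (\<lambda>H. Digraph.graph H \<and> Digraph_Component.connected H \<and> (\<forall>v \<in> verts H. \<not> cut_vertex H v)) B}"

definition spanning_path :: "('a, 'b) pre_digraph \<Rightarrow> 'a \<Rightarrow> 'a list \<Rightarrow> 'a \<Rightarrow> bool" where
  "spanning_path B u p v \<longleftrightarrow> vpath p B \<and> set p = verts B \<and> hd p = u \<and> last p = v"

definition good_block :: "('a, 'b) pre_digraph \<Rightarrow> ('a, 'b) pre_digraph \<Rightarrow> bool" where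
  "good_block G B \<longleftrightarrow> (\<exists>u \<in> verts B. \<exists>v \<in> verts B.
     u \<noteq> v \<and> cut_vertex G u \<and> cut_vertex G v \<and> (\<exists>p. spanning_path B u p v))"

definition Bad :: "('a, 'b) pre_digraph \<Rightarrow> ('a, 'b) pre_digraph set" where
  "Bad G = {B \<in> blocks G. \<not> good_block G B}"

text \<open>
  The library's \<open>forest\<close>, \<open>tree\<close> and \<open>spanning_tree\<close> exclude directed cycles. They do not fit
  here: the two arcs of a single edge already form a directed cycle, whereas an acyclic
  orientation of a triangle has none. In a \<open>graph\<close>, the directed cycles of length at least 3
  are exactly the (oriented) undirected cycles.
\<close>

definition undirected_tree :: "('a, 'b) pre_digraph \<Rightarrow> bool" where
  "undirected_tree T \<longleftrightarrow> Digraph.graph T \<and> Digraph_Component.connected T \<and>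
     \<not> (\<exists>c. pre_digraph.cycle T c \<and> 3 \<le> length c)"

definition undirected_spanning_tree ::
    "('a, 'b) pre_digraph \<Rightarrow> ('a, 'b) pre_digraph \<Rightarrow> bool" where
  "undirected_spanning_tree T G \<longleftrightarrow> undirected_tree T \<and> spanning T G"

text \<open>In a \<open>graph\<close>, the out-degree of a vertex is its undirected degree.\<close>

definition internal_verts :: "('a, 'b) pre_digraph \<Rightarrow> 'a set" where
  "internal_verts T = {v \<in> verts T. 2 \<le> out_degree T v}"

end

theory Submission
  imports Defs
begin

text \<open>
  In every block choose a spanning path, between two distinct cut vertices if the block is good and
  starting at a cut vertex otherwise; \<open>T\<close> is the union of these paths. Attaching an ear (a path
  between two distinct vertices) to a connected graph without cut vertices creates no cut vertex.
  Hence blocks share at most one vertex, the cut vertices are the vertices lying in several blocks,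
  and a cycle of \<open>T\<close> would lie in a single block, that is, on one of the paths. A cut vertex has
  a \<open>T\<close>-neighbour in each of its blocks, and a vertex in only one block is a leaf of \<open>T\<close> iff it is
  the end of the path of that block, so the leaves correspond to the bad blocks.

  Vertex sets and the adjacency relation carry the argument: the blocks are the subgraphs
  induced by the maximal vertex sets satisfying \<open>biconn\<close>.
\<close>

subsection \<open>Connectedness after removing a vertex\<close>

lemma set_vwalk_arcs_conv: "set (vwalk_arcs p) = {(p ! i, p ! Suc i) |i. Suc i < length p}"
proof (induction p rule: vwalk_arcs.induct)
  case (3 x y xs)
  have *: "{e. \<exists>i. e = (q ! i, q ! Suc i) \<and> Suc i < length q} = (\<lambda>i. (q ! i, q ! Suc i)) ` {..<length q - 1}"
    for q :: "'a list" by auto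
  show ?case using 3 unfolding * by (simp add: lessThan_Suc_eq_insert_0 image_image)
qed auto

text \<open>\<open>rtrancl_on S E\<close> keeps the whole walk inside \<open>S\<close>, so deleting
  a vertex means shrinking \<open>S\<close> while \<open>E\<close> stays fixed.\<close>

definition conn_on :: "('a \<times> 'a) set \<Rightarrow> 'a set \<Rightarrow> bool" where
  "conn_on E S \<longleftrightarrow> (\<forall>x \<in> S. \<forall>y \<in> S. (x, y) \<in> rtrancl_on S E)"

text \<open>The empty set passes \<open>conn_on\<close> vacuously and is excluded here; single
  vertices qualify, and so do single edges of a symmetric \<open>E\<close>.\<close>

definition biconn :: "('a \<times> 'a) set \<Rightarrow> 'a set \<Rightarrow> bool" where
  "biconn E S \<longleftrightarrow> S \<noteq> {} \<and> conn_on E S \<and> (\<forall>w \<in> S. conn_on E (S - {w}))"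

lemma rtrancl_on_walk:
  assumes "p \<noteq> []" "set (vwalk_arcs p) \<subseteq> E" "set p \<subseteq> S"
  shows "(hd p, last p) \<in> rtrancl_on S E"
  using assms
proof (induction p rule: vwalk_arcs.induct)
  case (3 x y p)
  then have "(y, last (y # p)) \<in> rtrancl_on S E" by simp
  then show ?case using 3 by (simp add: converse_rtrancl_on_into_rtrancl_on[of x y])
qed auto

text \<open>Loops are erased along the induction: if the new first vertex already occurs on the
  path, only the part from that vertex on is kept.\<close>

lemma rtrancl_on_path:
  assumes "(x, y) \<in> rtrancl_on S E"
  obtains p where "p \<noteq> []" "distinct p" "hd p = x" "last p = y" "set p \<subseteq> S"
    "set (vwalk_arcs p) \<subseteq> E"
proof -
  from assms have "\<exists>p. p \<noteq> [] \<and> distinct p \<and> hd p = x \<and> last p = y \<and> set p \<subseteq> S \<and>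
    set (vwalk_arcs p) \<subseteq> E"
  proof (induction rule: converse_rtrancl_on_induct)
    case base
    then show ?case by (intro exI[of _ "[y]"]) auto
  next
    case (step x z)
    then obtain p where p: "p \<noteq> []" "distinct p" "hd p = z" "last p = y" "set p \<subseteq> S"
      "set (vwalk_arcs p) \<subseteq> E" by blast
    show ?case
    proof (cases "x \<in> set p")
      case True
      then obtain a b where ab: "p = a @ x # b" by (auto dest: split_list)
      then have "set (vwalk_arcs (x # b)) \<subseteq> set (vwalk_arcs p)"
        by (simp add: set_vwalk_arcs_append2)
      then show ?thesis using p ab by (intro exI[of _ "x # b"]) auto
    next
      case False
      then show ?thesis using p step by (intro exI[of _ "x # p"]) auto
    qed
  qed
  then show thesis using that by blast
qed

lemma conn_on_via:
  assumes "sym E" "S \<subseteq> X" "\<And>x y. x \<in> S \<Longrightarrow> y \<in> S \<Longrightarrow> (x, y) \<in> rtrancl_on X E"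
    and "\<And>x. x \<in> X \<Longrightarrow> \<exists>s \<in> S. (x, s) \<in> rtrancl_on X E"
  shows "conn_on E X"
  unfolding conn_on_def
proof (intro ballI)
  fix x y assume "x \<in> X" "y \<in> X"
  then obtain s t where "s \<in> S" "t \<in> S" "(x, s) \<in> rtrancl_on X E" "(y, t) \<in> rtrancl_on X E"
    using assms(4) by meson
  moreover have "(t, y) \<in> rtrancl_on X E"
    using calculation(4) rtrancl_on_sym[OF \<open>sym E\<close>] by (auto elim: symE)
  ultimately show "(x, y) \<in> rtrancl_on X E"
    by (meson assms(3) rtrancl_on_trans)
qed

lemma conn_on_superset:
  assumes "sym E" "conn_on E S" "S \<subseteq> X" "\<And>x. x \<in> X - S \<Longrightarrow> \<exists>s \<in> S. (x, s) \<in> rtrancl_on X E"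
  shows "conn_on E X"
proof (rule conn_on_via[OF \<open>sym E\<close> \<open>S \<subseteq> X\<close>])
  show "(x, y) \<in> rtrancl_on X E" if "x \<in> S" "y \<in> S" for x y
    using that assms(2) rtrancl_on_mono[OF order_refl \<open>S \<subseteq> X\<close>] unfolding conn_on_def by blast
  show "\<exists>s \<in> S. (x, s) \<in> rtrancl_on X E" if "x \<in> X" for x
    using that assms(3,4) by (cases "x \<in> S") auto
qed

lemma conn_on_mono: "conn_on E S \<Longrightarrow> E \<subseteq> F \<Longrightarrow> conn_on F S"
  unfolding conn_on_def by (auto intro: rtrancl_on_mono[of E F S S])

lemma biconn_mono: "biconn E S \<Longrightarrow> E \<subseteq> F \<Longrightarrow> biconn F S"
  unfolding biconn_def by (auto intro: conn_on_mono[of E _ F])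

lemma biconn_conn_minus: "biconn E S \<Longrightarrow> conn_on E (S - {w})"
  unfolding biconn_def by (cases "w \<in> S") auto

lemma biconn_edge:
  assumes "sym E" "(x, y) \<in> E" shows "biconn E {x, y}"
proof -
  have "(y, x) \<in> E" using assms by (auto elim: symE)
  then have "conn_on E {x, y}" unfolding conn_on_def
    using \<open>(x, y) \<in> E\<close> by (auto intro: rtrancl_on_into_rtrancl_on)
  moreover have "conn_on E ({x, y} - {w})" if "w \<in> {x, y}" for w
    using that unfolding conn_on_def by auto
  ultimately show ?thesis unfolding biconn_def by blast
qed

text \<open>Whichever vertex is deleted, \<open>x\<close> or \<open>y\<close> survives and joins
  what remains of \<open>S\<close> to what remains of \<open>S'\<close>.\<close>

lemma biconn_union:
  assumes "sym E" "biconn E S" "biconn E S'" "x \<in> S \<inter> S'" "y \<in> S \<inter> S'" "x \<noteq> y"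
  shows "biconn E (S \<union> S')"
proof -
  have *: "conn_on E (A \<union> B)" if "conn_on E A" "conn_on E B" "z \<in> A \<inter> B" for A B z
  proof (rule conn_on_superset[OF \<open>sym E\<close> that(1)])
    fix v assume "v \<in> A \<union> B - A"
    then have "(v, z) \<in> rtrancl_on B E" using that by (auto simp: conn_on_def)
    then have "(v, z) \<in> rtrancl_on (A \<union> B) E" by (rule rtrancl_on_mono[rotated 2]) auto
    then show "\<exists>s \<in> A. (v, s) \<in> rtrancl_on (A \<union> B) E" using that by blast
  qed auto
  have "conn_on E (S \<union> S' - {w})" for w
  proof -
    have "\<exists>z. z \<in> (S - {w}) \<inter> (S' - {w})" using assms(4-6) by (cases "w = x") auto
    then show ?thesis using *[OF assms(2,3)[THEN biconn_conn_minus]] by (metis Un_Diff)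
  qed
  moreover have "conn_on E (S \<union> S')" using assms(2-4) * unfolding biconn_def by blast
  ultimately show ?thesis using assms(2) unfolding biconn_def by simp
qed

text \<open>As the vertices of the ear \<open>p\<close> are distinct, a deleted vertex lies on at
  most one side of any remaining ear vertex, which still reaches an end of \<open>p\<close> in
  \<open>S\<close> along the other side.\<close>

lemma biconn_ear:
  assumes E: "sym E" and S: "biconn E S"
    and p: "distinct p" "set (vwalk_arcs p) \<subseteq> E" "hd p \<in> S" "last p \<in> S" "hd p \<noteq> last p"
  shows "biconn E (S \<union> set p)"
proof -
  have rs: "sym (rtrancl_on X E)" for X using E by (rule rtrancl_on_sym)
  \<comment> \<open>The empty \<open>W\<close> gives connectedness, a singleton gives connectedness
    after a deletion, also of a vertex outside \<open>S\<close>.\<close>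
  have step: "conn_on E (S \<union> set p - W)" if "conn_on E (S - W)" "W = {} \<or> W = {w}" for W w
  proof (rule conn_on_superset[OF E that(1)])
    fix x assume x: "x \<in> S \<union> set p - W - (S - W)"
    then have "x \<in> set p" by auto
    then obtain a b where ab: "p = a @ x # b" by (auto dest: split_list)
    have arcs: "set (vwalk_arcs (a @ [x])) \<subseteq> E" "set (vwalk_arcs (x # b)) \<subseteq> E"
      using p(2) set_vwalk_arcs_append1[of "a @ [x]" b] set_vwalk_arcs_append2[of "x # b" a] ab by auto
    show "\<exists>s \<in> S - W. (x, s) \<in> rtrancl_on (S \<union> set p - W) E"
    proof (cases "W \<inter> set a = {}")
      case True
      have "(hd (a @ [x]), last (a @ [x])) \<in> rtrancl_on (S \<union> set p - W) E"
        using arcs True x ab by (intro rtrancl_on_walk) auto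
      then have "(x, hd p) \<in> rtrancl_on (S \<union> set p - W) E"
        using rs ab by (cases a) (auto elim: symE)
      moreover have "hd p \<in> S - W" using in_rtrancl_on_in_F[OF calculation] p(3) by auto
      ultimately show ?thesis by auto
    next
      case False
      then have "w \<in> set a" "W = {w}" using that(2) by auto
      then have "W \<inter> set b = {}" using p(1) ab by auto
      then have "(hd (x # b), last (x # b)) \<in> rtrancl_on (S \<union> set p - W) E"
        using arcs x ab by (intro rtrancl_on_walk) auto
      then have "(x, last p) \<in> rtrancl_on (S \<union> set p - W) E"
        using ab by auto
      moreover have "last p \<in> S - W" using in_rtrancl_on_in_F[OF calculation] p(4) by auto
      ultimately show ?thesis by auto
    qed
  qed auto
  show ?thesis using step[of "{}"] step S biconn_conn_minus[OF S]
    unfolding biconn_def by auto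
qed

text \<open>The closing edge of the cycle is biconnected by itself, and the cycle without it is an
  ear between its two ends.\<close>

lemma biconn_cycle:
  assumes "sym E" "distinct c" "set (vwalk_arcs (last c # c)) \<subseteq> E" "3 \<le> length c"
  shows "biconn E (set c)"
proof -
  obtain x y d where c: "c = x # d @ [y]"
    using assms(4) by (cases c; cases "tl c" rule: rev_cases) auto
  have "biconn E {y, x}" using assms(3) c by (intro biconn_edge[OF assms(1)]) auto
  then have "biconn E ({y, x} \<union> set c)"
    using assms c by (intro biconn_ear) auto
  then show ?thesis using c by (simp add: insert_absorb insert_commute)
qed

section \<open>Edges of a path and neighbours on a cycle\<close>

definition path_edges :: "'a list \<Rightarrow> ('a \<times> 'a) set" where
  "path_edges p = set (vwalk_arcs p) \<union> (set (vwalk_arcs p))\<inverse>"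

lemma sym_path_edges: "sym (path_edges p)"
  unfolding path_edges_def by (rule sym_Un_converse)

lemma path_edges_nth:
  assumes "distinct p" "i < length p"
  shows "(p ! i, y) \<in> path_edges p \<longleftrightarrow>
    (Suc i < length p \<and> y = p ! Suc i) \<or> (0 < i \<and> y = p ! (i - 1))"
proof -
  have "(p ! i, y) \<in> set (vwalk_arcs p) \<longleftrightarrow> Suc i < length p \<and> y = p ! Suc i"
    using assms by (auto simp: set_vwalk_arcs_conv nth_eq_iff_index_eq)
  moreover have "(y, p ! i) \<in> set (vwalk_arcs p) \<longleftrightarrow> 0 < i \<and> y = p ! (i - 1)"
  proof
    assume "(y, p ! i) \<in> set (vwalk_arcs p)"
    then obtain j where "y = p ! j" "p ! i = p ! Suc j" "Suc j < length p"
      by (auto simp: set_vwalk_arcs_conv)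
    then show "0 < i \<and> y = p ! (i - 1)" using assms by (auto simp: nth_eq_iff_index_eq)
  qed (use assms in \<open>auto simp: set_vwalk_arcs_conv intro!: exI[of _ "i - 1"]\<close>)
  ultimately show ?thesis by (auto simp: path_edges_def)
qed

lemma path_edges_in_set: "(x, y) \<in> path_edges p \<Longrightarrow> x \<in> set p \<and> y \<in> set p"
  by (auto simp: path_edges_def set_vwalk_arcs_conv)

text \<open>The vertex of \<open>C\<close> that comes first on the path has only one neighbour in \<open>C\<close>.\<close>

lemma path_edges_acyclic:
  assumes "distinct p" "C \<noteq> {}"
    and two: "\<And>x. x \<in> C \<Longrightarrow> \<exists>y \<in> C. \<exists>z \<in> C. y \<noteq> z \<and> (x, y) \<in> path_edges p \<and> (x, z) \<in> path_edges p"
  shows False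
proof -
  have "C \<subseteq> set p" using two path_edges_in_set by fast
  then have "\<exists>i. i < length p \<and> p ! i \<in> C" using \<open>C \<noteq> {}\<close> by (auto simp: in_set_conv_nth subset_iff)
  then obtain i where i: "i < length p" "p ! i \<in> C" "\<And>j. j < i \<Longrightarrow> j < length p \<Longrightarrow> p ! j \<notin> C"
    using exists_least_iff[of "\<lambda>i. i < length p \<and> p ! i \<in> C"] by blast
  obtain y z where "y \<in> C" "z \<in> C" "y \<noteq> z" "(p ! i, y) \<in> path_edges p" "(p ! i, z) \<in> path_edges p"
    using two i(2) by blast
  then show False using i(1) i(3)[of "i - 1"] by (auto simp: path_edges_nth[OF assms(1) i(1)])
qed

lemma cycle_two_neighbours:
  assumes "distinct c" "3 \<le> length c" "x \<in> set c" "set (vwalk_arcs (last c # c)) \<subseteq> F" "sym F"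
  shows "\<exists>y \<in> set c. \<exists>z \<in> set c. y \<noteq> z \<and> (x, y) \<in> F \<and> (x, z) \<in> F"
proof -
  obtain i where i: "i < length c" "x = c ! i" using assms(3) by (auto simp: in_set_conv_nth)
  let ?k = "length c"
  have edge: "(c ! j, c ! Suc j) \<in> F" if "Suc j < ?k" for j
    using that assms(4) by (fastforce simp: set_vwalk_arcs_conv)
  have edge0: "(c ! (?k - 1), c ! 0) \<in> F"
    using assms(2,4) by (cases c) (auto simp: last_conv_nth split: if_splits)
  \<comment> \<open>Cyclic successor and predecessor of \<open>i\<close>, wrapping around at the
    ends; they differ because the cycle has at least three vertices.\<close>
  define s where "s = (if Suc i < ?k then Suc i else 0)"
  define t where "t = (if 0 < i then i - 1 else ?k - 1)"
  have st: "s < ?k" "t < ?k" "s \<noteq> t" using assms(2) i by (auto simp: s_def t_def)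
  have "(x, c ! s) \<in> F"
  proof (cases "Suc i < ?k")
    case False
    then have "i = ?k - 1" using i by simp
    then show ?thesis using edge0 i False by (simp add: s_def)
  qed (use edge i in \<open>simp add: s_def\<close>)
  moreover have "(c ! t, x) \<in> F" using edge[of "i - 1"] edge0 i by (auto simp: t_def)
  then have "(x, c ! t) \<in> F" using assms(5) by (auto elim: symE)
  moreover have "c ! s \<noteq> c ! t"
    using st assms(1) by (simp add: nth_eq_iff_index_eq)
  ultimately show ?thesis using st(1,2) by (meson nth_mem)
qed

subsection \<open>Blocks and cut vertices\<close>

locale connected_relation =
  fixes V :: "'a set" and E :: "('a \<times> 'a) set"
  assumes finite_V: "finite V" and sym_E: "sym E" and E_sub: "E \<subseteq> V \<times> V"
    and irrefl_E: "(x, x) \<notin> E" and conn_V: "conn_on E V"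
begin

definition block :: "'a set \<Rightarrow> bool" where
  "block S \<longleftrightarrow> S \<subseteq> V \<and> biconn E S \<and> (\<forall>S'. S \<subseteq> S' \<and> S' \<subseteq> V \<and> biconn E S' \<longrightarrow> S' = S)"

definition cut :: "'a \<Rightarrow> bool" where
  "cut v \<longleftrightarrow> v \<in> V \<and> \<not> conn_on E (V - {v})"

lemma block_sub: "block S \<Longrightarrow> S \<subseteq> V"
  and block_biconn: "block S \<Longrightarrow> biconn E S"
  and block_max: "block S \<Longrightarrow> biconn E S' \<Longrightarrow> S' \<subseteq> V \<Longrightarrow> S \<subseteq> S' \<Longrightarrow> S' = S"
  unfolding block_def by blast+

lemma biconn_in_block:
  assumes "biconn E A" "A \<subseteq> V"
  obtains S where "block S" "A \<subseteq> S"
proof -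
  let ?X = "{S \<in> Pow V. biconn E S}"
  have "finite ?X" using finite_V by simp
  moreover have "A \<in> ?X" using assms by simp
  ultimately obtain S where "S \<in> ?X" "A \<subseteq> S" "\<forall>B \<in> ?X. S \<subseteq> B \<longrightarrow> S = B"
    using finite_has_maximal2[of ?X A] by auto
  then show thesis using that[of S] unfolding block_def by auto
qed

lemma edge_in_block:
  assumes "(x, y) \<in> E"
  obtains S where "block S" "x \<in> S" "y \<in> S"
proof -
  have "{x, y} \<subseteq> V" using E_sub assms by auto
  then obtain S where "block S" "{x, y} \<subseteq> S"
    by (rule biconn_in_block[OF biconn_edge[OF sym_E assms]])
  then show thesis using that by simp
qed

text \<open>By \<open>biconn_union\<close> the union is biconnected, so both blocks, being maximal,
  equal it.\<close>

lemma block_inter: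
  assumes "block S" "block S'" "x \<in> S \<inter> S'" "y \<in> S \<inter> S'" "x \<noteq> y"
  shows "S = S'"
proof -
  have "biconn E (S \<union> S')"
    using assms block_biconn by (intro biconn_union[OF sym_E]) auto
  then have "S \<union> S' = S" "S \<union> S' = S'"
    using assms(1,2) block_sub block_max[of S "S \<union> S'"] block_max[of S' "S \<union> S'"] by auto
  then show ?thesis by simp
qed

lemma block_ear:
  assumes "block S" "distinct p" "set (vwalk_arcs p) \<subseteq> E" "set p \<subseteq> V"
    "hd p \<in> S" "last p \<in> S" "hd p \<noteq> last p"
  shows "set p \<subseteq> S"
proof -
  have "biconn E (S \<union> set p)"
    using assms block_biconn by (intro biconn_ear[OF sym_E]) auto
  then have "S \<union> set p = S" using assms(1,4) block_sub block_max by simp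
  then show ?thesis by auto
qed

text \<open>The second block rules out a graph with only one vertex. If \<open>S\<close> were
  \<open>{v}\<close>, connectedness would give an edge at \<open>v\<close> and maximality would put
  its other end into \<open>S\<close>; otherwise a walk inside \<open>S\<close> starts with the
  required edge.\<close>

lemma block_neighbour:
  assumes "block S" "v \<in> S" "block S'" "S' \<noteq> S"
  obtains x where "x \<in> S" "(v, x) \<in> E"
proof (cases "S = {v}")
  case True
  have "S' \<noteq> {}" using block_biconn[OF assms(3)] by (simp add: biconn_def)
  then obtain z where "z \<in> V" "z \<noteq> v"
    using True assms(4) block_sub[OF assms(3)] by (metis subset_singletonD subset_iff singletonI subsetI)
  then have "(v, z) \<in> rtrancl_on V E"
    using conn_V assms(1,2) block_sub by (auto simp: conn_on_def)
  then obtain c where "(v, c) \<in> E"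
    using \<open>z \<noteq> v\<close> by (cases rule: converse_rtrancl_on_cases) auto
  moreover from this have "{v, c} = S"
    using True E_sub assms(1) by (intro block_max biconn_edge sym_E) auto
  ultimately show thesis using that by blast
next
  case False
  then obtain y where "y \<in> S" "y \<noteq> v" using assms(2) by auto
  then have "(v, y) \<in> rtrancl_on S E"
    using block_biconn[OF assms(1)] assms(2) by (auto simp: biconn_def conn_on_def)
  then show thesis
  proof (cases rule: converse_rtrancl_on_cases)
    case (step c)
    then show thesis using that in_rtrancl_on_in_F(1)[OF step(2)] by simp
  qed (use \<open>y \<noteq> v\<close> in simp)
qed

text \<open>If \<open>v\<close> were no cut vertex, its neighbours \<open>b\<close> and
  \<open>a\<close> in the two blocks would be joined by a path avoiding \<open>v\<close>. Prefixed
  by \<open>v\<close>, this path is an ear on \<open>S\<close>, so \<open>b\<close> would be a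
  second common vertex of the blocks.\<close>

lemma cut_if_two_blocks:
  assumes "block S" "block S'" "S \<noteq> S'" "v \<in> S" "v \<in> S'"
  shows "cut v"
proof -
  obtain a where a: "a \<in> S" "(v, a) \<in> E" using block_neighbour assms by metis
  obtain b where b: "b \<in> S'" "(v, b) \<in> E" using block_neighbour assms by metis
  have "a \<noteq> v" "b \<noteq> v" using a b irrefl_E by auto
  have V: "v \<in> V" "a \<in> V" "b \<in> V" using assms a b block_sub by auto
  have "\<not> conn_on E (V - {v})"
  proof
    assume "conn_on E (V - {v})"
    then have "(b, a) \<in> rtrancl_on (V - {v}) E"
      using V \<open>a \<noteq> v\<close> \<open>b \<noteq> v\<close> by (auto simp: conn_on_def)
    then obtain p where p: "p \<noteq> []" "distinct p" "hd p = b" "last p = a" "set p \<subseteq> V - {v}"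
      "set (vwalk_arcs p) \<subseteq> E" by (rule rtrancl_on_path)
    have "set (v # p) \<subseteq> S"
      using p a b V assms(4) \<open>a \<noteq> v\<close> by (intro block_ear[OF assms(1)]) auto
    then have "b \<in> S" using p(1,3) hd_in_set by force
    then show False using block_inter[of S S' v b] assms b \<open>b \<noteq> v\<close> by auto
  qed
  then show ?thesis using V by (simp add: cut_def)
qed

text \<open>Every vertex other than \<open>v\<close> reaches a neighbour of \<open>v\<close> without passing \<open>v\<close>. So if all
  neighbours lie in one block \<open>S\<close>, the connectedness of \<open>S - {v}\<close> carries over to \<open>V - {v}\<close>.\<close>

lemma two_blocks_if_cut:
  assumes "cut v"
  obtains S S' where "block S" "block S'" "S \<noteq> S'" "v \<in> S" "v \<in> S'"
proof (rule ccontr)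
  note two = that
  assume neg: "\<not> thesis"
  have "v \<in> V" using assms by (simp add: cut_def)
  obtain S where S: "block S" "v \<in> S"
    using biconn_in_block[of "{v}"] \<open>v \<in> V\<close> by (auto simp: biconn_def conn_on_def)
  have nb: "x \<in> S" if "(v, x) \<in> E" for x
  proof -
    obtain S' where S': "block S'" "v \<in> S'" "x \<in> S'" using edge_in_block[OF \<open>(v, x) \<in> E\<close>] .
    then have "S = S'" using two[of S S'] neg S by blast
    then show "x \<in> S" using S' by simp
  qed
  have "conn_on E (V - {v})"
  proof (rule conn_on_superset[OF sym_E biconn_conn_minus[OF block_biconn[OF S(1)]]])
    show "S - {v} \<subseteq> V - {v}" using block_sub[OF S(1)] by auto
    fix x assume "x \<in> V - {v} - (S - {v})"
    then have "x \<in> V" "x \<noteq> v" by auto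
    then have "(x, v) \<in> rtrancl_on V E" using conn_V \<open>v \<in> V\<close> by (auto simp: conn_on_def)
    then show "\<exists>s \<in> S - {v}. (x, s) \<in> rtrancl_on (V - {v}) E" using \<open>x \<noteq> v\<close>
    proof (induction rule: converse_rtrancl_on_induct)
      case (step x y)
      show ?case
      proof (cases "y = v")
        case True
        then have "x \<in> S - {v}" using nb step sym_E by (auto elim: symE)
        then show ?thesis using step by auto
      next
        case False
        then obtain s where "s \<in> S - {v}" "(y, s) \<in> rtrancl_on (V - {v}) E" using step by auto
        then show ?thesis
          using step converse_rtrancl_on_into_rtrancl_on[OF step(1), of s "V - {v}"] by auto
      qed
    qed simp
  qed
  then show False using assms by (simp add: cut_def)
qed

end

subsection \<open>The union of the spanning paths\<close>

text \<open>The paths are oriented such that \<open>hd\<close> is a cut vertex; then the good blocks are those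
  where \<open>last\<close> is a cut vertex as well.\<close>

locale block_paths = connected_relation +
  fixes P :: "'a set \<Rightarrow> 'a list"
  assumes two_blocks: "\<exists>S S'. block S \<and> block S' \<and> S \<noteq> S'"
    and set_P: "block S \<Longrightarrow> set (P S) = S"
    and distinct_P: "block S \<Longrightarrow> distinct (P S)"
    and arcs_P: "block S \<Longrightarrow> set (vwalk_arcs (P S)) \<subseteq> E"
    and hd_P: "block S \<Longrightarrow> cut (hd (P S))"
begin

definition T :: "('a \<times> 'a) set" where
  "T = (\<Union>S \<in> Collect block. path_edges (P S))"

text \<open>These become the internal vertices: degree at least 2 is expressed by two distinct
  neighbours.\<close>

definition branching :: "'a set" where
  "branching = {v \<in> V. \<exists>y z. y \<noteq> z \<and> (v, y) \<in> T \<and> (v, z) \<in> T}"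

lemma T_sub: "T \<subseteq> E"
proof -
  have "path_edges (P S) \<subseteq> E" if "block S" for S
    using arcs_P[OF that] sym_E unfolding path_edges_def by (auto dest: symD)
  then show ?thesis unfolding T_def by blast
qed

lemma sym_T: "sym T"
  unfolding T_def by (rule sym_UNION) (simp add: sym_path_edges)

text \<open>Meant for vertices that are not cut vertices: there the degree in \<open>T\<close> is
  the degree on a single path.\<close>

lemma T_iff_if_unique_block:
  assumes "block S" "x \<in> S" "\<And>S'. block S' \<Longrightarrow> x \<in> S' \<Longrightarrow> S' = S"
  shows "(x, y) \<in> T \<longleftrightarrow> (x, y) \<in> path_edges (P S)"
proof
  assume "(x, y) \<in> T"
  then obtain S' where S': "block S'" "(x, y) \<in> path_edges (P S')" by (auto simp: T_def)
  then have "S' = S" using path_edges_in_set set_P assms(3) by metis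
  then show "(x, y) \<in> path_edges (P S)" using S' by simp
qed (use assms(1) in \<open>auto simp: T_def\<close>)

text \<open>The edge comes from the path of some block, and two blocks sharing both of its ends
  coincide.\<close>

lemma T_in_block:
  assumes "block S" "x \<in> S" "y \<in> S" "(x, y) \<in> T"
  shows "(x, y) \<in> path_edges (P S)"
proof -
  obtain S' where S': "block S'" "(x, y) \<in> path_edges (P S')" using assms(4) by (auto simp: T_def)
  then have "x \<in> S'" "y \<in> S'" using path_edges_in_set set_P by metis+
  moreover have "x \<noteq> y" using assms(4) T_sub irrefl_E by auto
  ultimately show ?thesis using block_inter[of S S' x y] assms S' by auto
qed

text \<open>An edge of \<open>E\<close> lies in a block \<open>S\<close>, whose path joins both of
  its ends to \<open>hd (P S)\<close>; so every walk of \<open>E\<close> can be replaced by a walk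
  of \<open>T\<close>.\<close>

lemma T_conn: "conn_on T V"
proof -
  have path: "(hd (P S), x) \<in> rtrancl_on V T" if S: "block S" and x: "x \<in> S" for S x
  proof -
    obtain a b where ab: "P S = a @ x # b" using x set_P[OF S] by (metis split_list)
    then have "set (vwalk_arcs (a @ [x])) \<subseteq> set (vwalk_arcs (P S))"
      using set_vwalk_arcs_append1[of "a @ [x]" b] by simp
    then have "set (vwalk_arcs (a @ [x])) \<subseteq> T" using S by (auto simp: T_def path_edges_def)
    moreover have "set (a @ [x]) \<subseteq> V" using ab set_P[OF S] block_sub[OF S] by auto
    ultimately have "(hd (a @ [x]), last (a @ [x])) \<in> rtrancl_on V T"
      by (intro rtrancl_on_walk) auto
    then show ?thesis using ab by (cases a) auto
  qed
  have edge: "(x, y) \<in> rtrancl_on V T" if "(x, y) \<in> E" for x y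
  proof -
    obtain S where S: "block S" "x \<in> S" "y \<in> S" using edge_in_block[OF \<open>(x, y) \<in> E\<close>] .
    then have "(x, hd (P S)) \<in> rtrancl_on V T"
      using path rtrancl_on_sym[OF sym_T] by (auto elim: symE)
    then show ?thesis using path S rtrancl_on_trans by metis
  qed
  have "(x, y) \<in> rtrancl_on V T" if "(x, y) \<in> rtrancl_on V E" for x y
    using that by (induction rule: rtrancl_on_induct) (auto intro: rtrancl_on_trans edge)
  then show ?thesis using conn_V by (auto simp: conn_on_def)
qed

lemma T_acyclic:
  assumes "distinct c" "3 \<le> length c" "set (vwalk_arcs (last c # c)) \<subseteq> T"
  shows False
proof -
  have "biconn E (set c)" using assms T_sub sym_E by (intro biconn_cycle) auto
  \<comment> \<open>Each vertex of the cycle has a neighbour in \<open>T\<close>, hence lies in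
    \<open>V\<close>.\<close>
  moreover have "set c \<subseteq> V"
    using cycle_two_neighbours[OF assms(1,2) _ assms(3) sym_T] T_sub E_sub by blast
  ultimately obtain S where S: "block S" "set c \<subseteq> S" by (rule biconn_in_block)
  show False
  proof (rule path_edges_acyclic)
    show "distinct (P S)" using S distinct_P by simp
    show "set c \<noteq> {}" using assms(2) by auto
    show "\<exists>y \<in> set c. \<exists>z \<in> set c. y \<noteq> z \<and> (x, y) \<in> path_edges (P S) \<and> (x, z) \<in> path_edges (P S)"
      if "x \<in> set c" for x
      using cycle_two_neighbours[OF assms(1,2) that assms(3) sym_T] T_in_block[OF S(1)] S(2) that
      by blast
  qed
qed

lemma other_block: "\<exists>S'. block S' \<and> S' \<noteq> S"
  using two_blocks by blast

text \<open>Because there is another block, every block contains an edge.\<close>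

lemma two_le_length_P:
  assumes "block S" shows "2 \<le> length (P S)"
proof -
  obtain v where v: "v \<in> S" using block_biconn[OF assms] by (auto simp: biconn_def)
  obtain x where x: "x \<in> S" "(v, x) \<in> E" using block_neighbour assms v other_block by metis
  then have "card {v, x} \<le> card S" "v \<noteq> x"
    using v irrefl_E finite_subset[OF block_sub[OF assms] finite_V] by (auto intro: card_mono)
  then show ?thesis using distinct_card[OF distinct_P[OF assms]] set_P[OF assms] by simp
qed

lemma T_neighbour:
  assumes "block S" "v \<in> S"
  obtains x where "x \<in> S" "(v, x) \<in> T"
proof -
  obtain i where i: "i < length (P S)" "v = P S ! i"
    using assms set_P by (metis in_set_conv_nth)
  obtain x where "(v, x) \<in> path_edges (P S)"
    using path_edges_nth[OF distinct_P[OF assms(1)] i(1)] two_le_length_P[OF assms(1)] i(2)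
    by (cases "i = 0") auto
  then have "x \<in> S" "(v, x) \<in> T"
    using assms set_P path_edges_in_set[of v x "P S"] by (auto simp: T_def)
  then show thesis by (rule that)
qed

text \<open>There is a \<open>T\<close>-neighbour of \<open>v\<close> in each of two blocks, and
  these differ since the blocks share only \<open>v\<close>.\<close>

lemma cut_branching:
  assumes "cut v" shows "v \<in> branching"
proof -
  obtain S S' where S: "block S" "block S'" "S \<noteq> S'" "v \<in> S" "v \<in> S'"
    using two_blocks_if_cut[OF assms] .
  obtain x where x: "x \<in> S" "(v, x) \<in> T" using T_neighbour S by metis
  obtain y where y: "y \<in> S'" "(v, y) \<in> T" using T_neighbour S by metis
  have "v \<noteq> x" using x T_sub irrefl_E by auto
  then have "x \<noteq> y" using block_inter[of S S' v x] S x y by auto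
  then show ?thesis using x y assms by (auto simp: branching_def cut_def)
qed

text \<open>Not being a cut vertex, \<open>x\<close> lies in \<open>S\<close> only, so its
  \<open>T\<close>-neighbours are those on \<open>P S\<close>. It is not \<open>hd (P S)\<close>, so
  it has a predecessor there, and it lacks a successor exactly at the end.\<close>

lemma not_branching_iff:
  assumes "block S" "x \<in> S" "\<not> cut x"
  shows "x \<notin> branching \<longleftrightarrow> x = last (P S)"
proof -
  have T: "(x, y) \<in> T \<longleftrightarrow> (x, y) \<in> path_edges (P S)" for y
    using assms cut_if_two_blocks[OF assms(1)] by (intro T_iff_if_unique_block) auto
  let ?n = "length (P S)"
  obtain i where i: "i < ?n" "x = P S ! i" using assms set_P by (metis in_set_conv_nth)
  note nb = path_edges_nth[OF distinct_P[OF assms(1)] i(1), folded i(2)]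
  have n: "2 \<le> ?n" "P S \<noteq> []" using two_le_length_P[OF assms(1)] by auto
  have "i \<noteq> 0" using hd_P[OF assms(1)] assms(3) i n hd_conv_nth by metis
  have last: "x = last (P S) \<longleftrightarrow> i = ?n - 1"
    using i n distinct_P[OF assms(1)] by (simp add: last_conv_nth nth_eq_iff_index_eq)
  have "x \<in> V" using assms block_sub by auto
  show ?thesis
  proof (cases "i = ?n - 1")
    case True
    have "y = P S ! (i - 1)" if "(x, y) \<in> T" for y
      using that True unfolding T nb by auto
    then show ?thesis using True last by (auto simp: branching_def)
  next
    case False
    then have "P S ! (i - 1) \<noteq> P S ! Suc i" "Suc i < ?n"
      using i distinct_P[OF assms(1)] by (auto simp: nth_eq_iff_index_eq)
    moreover from this have "(x, P S ! (i - 1)) \<in> T" "(x, P S ! Suc i) \<in> T"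
      using \<open>i \<noteq> 0\<close> unfolding T nb by auto
    ultimately have "x \<in> branching"
      using \<open>x \<in> V\<close> unfolding branching_def by blast
    then show ?thesis using False last by simp
  qed
qed

text \<open>Taking \<open>last (P S)\<close> matches the counted blocks with the vertices outside
  \<open>branching\<close>; it is injective since a last vertex shared by two blocks would be a cut
  vertex. The additive form avoids truncated subtraction.\<close>

lemma card_branching:
  "card branching + card {S. block S \<and> \<not> cut (last (P S))} = card V"
proof -
  let ?B = "{S. block S \<and> \<not> cut (last (P S))}"
  have last: "last (P S) \<in> S" if "block S" for S
    using set_P[OF that] two_le_length_P[OF that] last_in_set[of "P S"] by fastforce
  have inj: "inj_on (\<lambda>S. last (P S)) ?B"
  proof (rule inj_onI)
    fix S S' assume "S \<in> ?B" "S' \<in> ?B" "last (P S) = last (P S')"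
    then show "S = S'" using last[of S] last[of S'] cut_if_two_blocks[of S S'] by auto
  qed
  have "(\<lambda>S. last (P S)) ` ?B = V - branching"
  proof (intro equalityI subsetI)
    fix x assume "x \<in> (\<lambda>S. last (P S)) ` ?B"
    then obtain S where "block S" "\<not> cut x" "x = last (P S)" by auto
    then show "x \<in> V - branching" using last[of S] block_sub[of S] not_branching_iff[of S x] by auto
  next
    fix x assume x: "x \<in> V - branching"
    then have "\<not> cut x" using cut_branching by auto
    obtain S where "block S" "x \<in> S"
      using biconn_in_block[of "{x}"] x by (auto simp: biconn_def conn_on_def)
    then show "x \<in> (\<lambda>S. last (P S)) ` ?B"
      using \<open>\<not> cut x\<close> x not_branching_iff by blast
  qed
  then have "card ?B = card (V - branching)" using card_image[OF inj] by simp
  moreover have "branching \<subseteq> V" by (auto simp: branching_def)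
  ultimately show ?thesis
    using finite_V card_mono[of V branching] finite_subset[of branching V]
    by (simp add: card_Diff_subset)
qed

end

subsection \<open>Passing to digraphs\<close>

lemma conn_on_cong:
  assumes "E \<inter> S \<times> S = F \<inter> S \<times> S"
  shows "conn_on E S \<longleftrightarrow> conn_on F S"
proof -
  have "(x, y) \<in> rtrancl_on S F" if "(x, y) \<in> rtrancl_on S E" "E \<inter> S \<times> S = F \<inter> S \<times> S" for x y E F
    using that
  proof (induction rule: rtrancl_on_induct)
    case (step y z)
    then have "(y, z) \<in> F" by blast
    then show ?case using step rtrancl_on_into_rtrancl_on[of x y S F z] by simp
  qed simp
  from this[of _ _ E F] this[of _ _ F E] show ?thesis
    using assms unfolding conn_on_def by metis
qed

text \<open>The library's notion is strong connectedness of the symmetric closure, which changes no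
  reachability in a \<open>graph\<close>.\<close>

lemma connected_iff_conn_on:
  assumes "Digraph.graph H"
  shows "Digraph_Component.connected H \<longleftrightarrow> verts H \<noteq> {} \<and> conn_on (arcs_ends H) (verts H)"
proof -
  interpret H: graph H by fact
  show ?thesis
    using H.reachable_mk_symmetric_eq[OF H.sym_arcs]
    by (simp add: Digraph_Component.connected_def strongly_connected_def conn_on_def reachable_def)
qed

text \<open>Connectedness makes the condition that \<open>u\<close> reaches \<open>w\<close>
  automatic, and deleting \<open>v\<close> only drops the pairs containing \<open>v\<close>.\<close>

lemma cut_vertex_iff:
  assumes "Digraph.graph H" "Digraph_Component.connected H"
  shows "cut_vertex H v \<longleftrightarrow> v \<in> verts H \<and> \<not> conn_on (arcs_ends H) (verts H - {v})"
proof -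
  have "arcs_ends (pre_digraph.del_vert H v) = arcs_ends H \<inter> (- {v}) \<times> (- {v})"
    by (auto simp: arcs_ends_conv pre_digraph.del_vert_simps)
  then have "conn_on (arcs_ends H) (verts H - {v}) \<longleftrightarrow>
      conn_on (arcs_ends (pre_digraph.del_vert H v)) (verts H - {v})"
    by (intro conn_on_cong) auto
  moreover have "u \<rightarrow>\<^sup>*\<^bsub>H\<^esub> w" if "u \<in> verts H" "w \<in> verts H" for u w
    using assms that by (simp add: connected_iff_conn_on conn_on_def reachable_def)
  ultimately show ?thesis
    by (auto simp: cut_vertex_def conn_on_def reachable_def pre_digraph.verts_del_vert)
qed

lemma connected_without_cut_vertex_iff:
  assumes "Digraph.graph H"
  shows "Digraph_Component.connected H \<and> (\<forall>v \<in> verts H. \<not> cut_vertex H v) \<longleftrightarrow>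
    biconn (arcs_ends H) (verts H)"
proof (cases "Digraph_Component.connected H")
  case True
  then show ?thesis
    using connected_iff_conn_on[OF assms] cut_vertex_iff[OF assms] by (auto simp: biconn_def)
next
  case False
  then show ?thesis using connected_iff_conn_on[OF assms] by (auto simp: biconn_def)
qed

lemma arcs_ends_induce_subgraph: "arcs_ends (G \<restriction> S) = arcs_ends G \<inter> S \<times> S"
  by (auto simp: arcs_ends_conv)

lemma spanning_path_rev:
  assumes "symmetric B" "spanning_path B u p v" shows "spanning_path B v (rev p) u"
  using assms vwalk_rev_ex[OF assms(1)]
  by (auto simp: spanning_path_def vpath_def hd_rev last_rev)

lemma two_le_card_iff:
  assumes "finite A" shows "2 \<le> card A \<longleftrightarrow> (\<exists>x \<in> A. \<exists>y \<in> A. x \<noteq> y)"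
  using card_le_Suc0_iff_eq[OF assms] by (auto simp: not_less_eq_eq[symmetric] numeral_2_eq_2)

section \<open>Blocks of a graph as induced subgraphs\<close>

context Digraph.graph
begin

lemma graph_subgraph: "subgraph H G \<Longrightarrow> symmetric H \<Longrightarrow> Digraph.graph H"
  by (rule digraph.graphI[OF digraph_subgraph])

lemma graph_induce_subgraph:
  assumes "S \<subseteq> verts G" shows "Digraph.graph (G \<restriction> S)"
proof (rule graph_subgraph)
  show "subgraph (G \<restriction> S) G" using assms by (rule subgraph_induce_subgraphI)
  show "symmetric (G \<restriction> S)"
    using graph_symmetric by (auto simp: symmetric_def arcs_ends_induce_subgraph sym_def)
qed

lemma biconn_induce_subgraph: "biconn (arcs_ends (G \<restriction> S)) S \<longleftrightarrow> biconn (arcs_ends G) S"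
  unfolding biconn_def arcs_ends_induce_subgraph
  by (intro conj_cong refl conn_on_cong ball_cong) auto

text \<open>Adding all edges between its vertices keeps a subgraph biconnected, so maximal subgraphs
  are induced, and maximality among subgraphs becomes maximality among vertex sets.\<close>

lemma blocks_eq:
  assumes "connected_relation (verts G) (arcs_ends G)"
  shows "blocks G = (\<lambda>S. G \<restriction> S) ` Collect (connected_relation.block (verts G) (arcs_ends G))"
proof -
  interpret R: connected_relation "verts G" "arcs_ends G" by fact
  define Q where "Q = (\<lambda>H :: ('a, 'b) pre_digraph. Digraph.graph H \<and> Digraph_Component.connected H \<and> (\<forall>v \<in> verts H. \<not> cut_vertex H v))"
  have blocks: "B \<in> blocks G \<longleftrightarrow> subgraph B G \<and> Q B \<and>
      (\<forall>H. subgraph B H \<longrightarrow> subgraph H G \<longrightarrow> Q H \<longrightarrow> H = B)" for B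
    unfolding blocks_def max_subgraph_def Q_def by blast
  have Q_iff: "Q H \<longleftrightarrow> Digraph.graph H \<and> biconn (arcs_ends H) (verts H)" for H
    using connected_without_cut_vertex_iff[of H] unfolding Q_def by auto
  have Q: "Q (G \<restriction> S)" if "S \<subseteq> verts G" "biconn (arcs_ends G) S" for S
    using that graph_induce_subgraph biconn_induce_subgraph by (simp add: Q_iff)
  have ind: "subgraph H (G \<restriction> S)" if "subgraph H G" "verts H \<subseteq> S" for H S
  proof -
    interpret H: wf_digraph H using that(1) by (simp add: subgraph_def)
    have "tail G = tail H" "head G = head H" using that(1) by (auto simp: subgraph_def compatible_def)
    then show ?thesis
      using that H.wellformed by (auto simp: subgraph_def compatible_def wellformed_induce_subgraph)
  qed
  have biconn: "biconn (arcs_ends G) (verts H)" if "subgraph H G" "Q H" for H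
    using that(2) biconn_mono[OF _ arcs_ends_mono[OF that(1)]] by (simp add: Q_iff)
  show ?thesis
  proof (intro equalityI subsetI)
    fix B assume "B \<in> blocks G"
    then have B: "subgraph B G" "Q B"
      and max: "\<And>H. subgraph B H \<Longrightarrow> subgraph H G \<Longrightarrow> Q H \<Longrightarrow> H = B"
      unfolding blocks by simp_all
    \<comment> \<open>With \<open>S = verts B\<close> this shows that \<open>B\<close> is induced,
      with larger \<open>S\<close> that \<open>verts B\<close> is maximal.\<close>
    have eq: "G \<restriction> S = B" if "verts B \<subseteq> S" "S \<subseteq> verts G" "biconn (arcs_ends G) S" for S
      using that by (intro max ind[OF B(1)] subgraph_induce_subgraphI Q)
    have S: "verts B \<subseteq> verts G" "biconn (arcs_ends G) (verts B)"
      using B(1) biconn[OF B] by (simp_all add: subgraph_imp_subverts)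
    have "S = verts B" if "verts B \<subseteq> S" "S \<subseteq> verts G" "biconn (arcs_ends G) S" for S
      using eq[OF that] by (metis induce_subgraph_verts)
    then have "R.block (verts B)" using S unfolding R.block_def by blast
    moreover have "B = G \<restriction> verts B" using eq[OF order_refl S] by simp
    ultimately show "B \<in> (\<lambda>S. G \<restriction> S) ` Collect R.block" by blast
  next
    fix B assume "B \<in> (\<lambda>S. G \<restriction> S) ` Collect R.block"
    then obtain S where S: "R.block S" and B: "B = G \<restriction> S" by auto
    have "H = B" if H: "subgraph B H" "subgraph H G" "Q H" for H
    proof -
      \<comment> \<open>The set \<open>verts H\<close> is biconnected and contains \<open>S\<close>,
        so maximality fixes it; then \<open>H\<close> and \<open>B\<close> are subgraphs of each
        other.\<close>
      have "verts H = S"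
        using R.block_max[OF S biconn[OF H(2,3)]] subgraph_imp_subverts[OF H(1)]
          subgraph_imp_subverts[OF H(2)] B by simp
      then have "subgraph H B" using ind[OF H(2)] B by simp
      then show ?thesis using H(1) by (intro pre_digraph.equality) (auto simp: subgraph_def compatible_def)
    qed
    then show "B \<in> blocks G"
      using Q[of S] subgraph_induce_subgraphI[of S] R.block_sub[OF S] R.block_biconn[OF S] B
      unfolding blocks by simp
  qed
qed

end

theorem theorem2:
  fixes G :: "('a, 'b) pre_digraph" and n :: nat
  assumes "Digraph.graph G"
    and "Digraph_Component.connected G"
    and "card (verts G) = n"
    and "2 \<le> card (blocks G)"
    and "\<forall>B \<in> blocks G. \<exists>u p v. spanning_path B u p v \<and> (cut_vertex G u \<or> cut_vertex G v)"
  shows "\<exists>T. undirected_spanning_tree T G \<and>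
    int (card (internal_verts T)) = int n - int (card (Bad G))"
proof -
  interpret G: Digraph.graph G by fact
  interpret R: connected_relation "verts G" "arcs_ends G"
  proof
    show "arcs_ends G \<subseteq> verts G \<times> verts G" by (auto dest: G.adj_in_verts)
    show "sym (arcs_ends G)" using G.sym_arcs by (simp add: symmetric_def)
    show "(x, x) \<notin> arcs_ends G" for x using G.adj_not_same by blast
    show "conn_on (arcs_ends G) (verts G)" using assms(1,2) by (simp add: connected_iff_conn_on)
  qed simp
  have blocks: "blocks G = (\<lambda>S. G \<restriction> S) ` Collect R.block"
    by (rule G.blocks_eq) unfold_locales
  have cut: "cut_vertex G v \<longleftrightarrow> R.cut v" for v
    using cut_vertex_iff[OF assms(1,2)] by (simp add: R.cut_def)
  have inj: "inj_on (\<lambda>S. G \<restriction> S) A" for A :: "'a set set"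
    by (rule inj_onI) (metis induce_subgraph_verts)
  have two: "\<exists>S S'. R.block S \<and> R.block S' \<and> S \<noteq> S'"
  proof -
    \<comment> \<open>Infinite sets have cardinality 0, so the bound on the number of blocks gives
      finiteness.\<close>
    have "finite (blocks G)" using assms(4) by (intro card_ge_0_finite) simp
    then obtain B B' where "B \<in> blocks G" "B' \<in> blocks G" "B \<noteq> B'"
      using assms(4) two_le_card_iff by blast
    then show ?thesis using blocks by auto
  qed
  \<comment> \<open>The last conjunct lets the bad blocks be counted as the blocks with a path whose
    last vertex is no cut vertex.\<close>
  let ?P = "\<lambda>S p. set p = S \<and> distinct p \<and> set (vwalk_arcs p) \<subseteq> arcs_ends G \<and> R.cut (hd p) \<and>
    (R.cut (last p) \<longleftrightarrow> good_block G (G \<restriction> S))"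
  have "\<exists>p. ?P S p" if S: "R.block S" for S
  proof -
    let ?B = "G \<restriction> S"
    have path: "set p = S \<and> distinct p \<and> set (vwalk_arcs p) \<subseteq> arcs_ends G \<and> hd p = u \<and> last p = v \<and>
        u \<in> S \<and> v \<in> S \<and> u \<noteq> v"
      if "spanning_path ?B u p v" for u p v
    proof -
      have p: "distinct p" "set (vwalk_arcs p) \<subseteq> arcs_ends G" "p \<noteq> []" "set p = S" "hd p = u" "last p = v"
        using that by (auto simp: spanning_path_def vpath_def vwalk_def arcs_ends_induce_subgraph)
      then have uv: "u \<in> S" "v \<in> S" by auto
      \<comment> \<open>Equal ends of a path without repetitions leave a single vertex, but
        \<open>S\<close> contains an edge because there is another block.\<close>
      have "u \<noteq> v"
      proof
        assume "u = v"
        then have "S = {u}" using p by (cases p) (auto split: if_splits)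
        moreover obtain S' where "R.block S'" "S' \<noteq> S" using two by blast
        ultimately show False using R.block_neighbour[OF S uv(1)] R.irrefl_E by blast
      qed
      then show ?thesis using p uv by blast
    qed
    show ?thesis
    proof (cases "good_block G ?B")
      case True
      then obtain u v p where "spanning_path ?B u p v" "R.cut u" "R.cut v"
        by (auto simp: good_block_def cut)
      then show ?thesis using True path[of u p v] by blast
    next
      case False
      have "?B \<in> blocks G" using S blocks by simp
      then obtain u p v where p: "spanning_path ?B u p v" "R.cut u \<or> R.cut v"
        using assms(5) cut by blast
      interpret B: Digraph.graph ?B by (rule G.graph_induce_subgraph[OF R.block_sub[OF S]])
      \<comment> \<open>Reversal brings the cut vertex to the front if it was at the end.\<close>
      have "spanning_path ?B v (rev p) u" using B.sym_arcs p(1) by (rule spanning_path_rev)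
      then obtain u p v where p: "spanning_path ?B u p v" "R.cut u"
        using p by (cases "R.cut u") auto
      \<comment> \<open>A cut vertex at the other end would make the block good.\<close>
      then have "\<not> R.cut v" using False path[OF p(1)] cut unfolding good_block_def by auto
      then show ?thesis using p(2) path[OF p(1)] False by blast
    qed
  qed
  then obtain P where P: "\<And>S. R.block S \<Longrightarrow> ?P S (P S)" by metis
  interpret X: block_paths "verts G" "arcs_ends G" P
    using two P by unfold_locales auto
  define T where "T = \<lparr>verts = verts G, arcs = {a \<in> arcs G. arc_to_ends G a \<in> X.T},
    tail = tail G, head = head G\<rparr>"
  have T_simps: "verts T = verts G" "tail T = tail G" "head T = head G"
    "arcs T = {a \<in> arcs G. arc_to_ends G a \<in> X.T}" by (simp_all add: T_def)
  have ends_T: "arcs_ends T = X.T"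
    using X.T_sub by (auto simp: arcs_ends_def arc_to_ends_def T_def)
  have "wf_digraph T" by unfold_locales (auto simp: T_simps)
  then have sub: "subgraph T G"
    by (auto simp: subgraph_def compatible_def T_simps G.wf_digraph)
  have T: "Digraph.graph T"
    using sub X.sym_T by (intro G.graph_subgraph) (simp_all add: symmetric_def ends_T)
  interpret T: Digraph.graph T by (rule T)
  have "Digraph_Component.connected T"
    using assms(1,2) X.T_conn by (simp add: connected_iff_conn_on T ends_T T_simps)
  moreover have "\<not> (\<exists>c. pre_digraph.cycle T c \<and> 3 \<le> length c)"
  proof
    assume "\<exists>c. pre_digraph.cycle T c \<and> 3 \<le> length c"
    then obtain c u where c: "T.awalk u c u" "distinct (tl (T.awalk_verts u c))" "3 \<le> length c"
      by (auto simp: T.cycle_def)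
    let ?vs = "T.awalk_verts u c"
    have "hd ?vs = u" "last ?vs = u" using c(1) by auto
    moreover have "length ?vs = Suc (length c)" by (rule T.length_awalk_verts)
    \<comment> \<open>Dropping the first \<open>u\<close> from the vertex list leaves the distinct
      list \<open>d\<close>, which ends in \<open>u\<close>, so \<open>last d # d\<close> is the
      whole list again.\<close>
    ultimately obtain d where d: "?vs = u # d" "length d = length c" "last d = u"
      using c(3) by (cases ?vs) (auto split: if_splits)
    have "set (vwalk_arcs ?vs) \<subseteq> X.T"
      using T.awalk_imp_vwalk[OF c(1)] by (simp add: vwalk_def ends_T)
    then show False using X.T_acyclic[of d] c d by simp
  qed
  moreover have "internal_verts T = X.branching"
  proof -
    have "2 \<le> out_degree T v \<longleftrightarrow> (\<exists>y z. y \<noteq> z \<and> (v, y) \<in> X.T \<and> (v, z) \<in> X.T)" for v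
    proof -
      have "arc_to_ends T ` out_arcs T v = {v} \<times> {y. (v, y) \<in> X.T}"
        unfolding ends_T[symmetric] by (auto simp: arcs_ends_def arc_to_ends_def)
      \<comment> \<open>There are no parallel arcs, so the out-degree counts the neighbours in
        \<open>X.T\<close>.\<close>
      moreover have "inj_on (arc_to_ends T) (out_arcs T v)"
        using T.inj_on_arc_to_ends by (rule inj_on_subset) auto
      ultimately have "out_degree T v = card ({v} \<times> {y. (v, y) \<in> X.T})"
        unfolding out_degree_def by (metis card_image)
      moreover have "finite ({v} \<times> {y. (v, y) \<in> X.T})"
        using \<open>arc_to_ends T ` out_arcs T v = _\<close> T.finite_out_arcs by (metis finite_imageI)
      ultimately show ?thesis by (auto simp: two_le_card_iff)
    qed
    then show ?thesis by (simp add: internal_verts_def X.branching_def T_simps)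
  qed
  moreover have "card (Bad G) = card {S. R.block S \<and> \<not> R.cut (last (P S))}"
  proof -
    have "Bad G = (\<lambda>S. G \<restriction> S) ` {S. R.block S \<and> \<not> R.cut (last (P S))}"
      using P blocks by (auto simp: Bad_def)
    then show ?thesis using card_image[OF inj] by simp
  qed
  ultimately show ?thesis
    using T sub X.card_branching assms(3)
    by (intro exI[of _ T])
      (auto simp: undirected_spanning_tree_def undirected_tree_def spanning_def T_simps)
qed

end
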